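(* The class of proper interval graphs is strictly contained in the class of exactly hittable interval graphs, which is strictly contained in the class of interval graphs.
   Context: An interval representation of a graph $G=(V,E)$ is a family of intervals of consecutive integers $\{I(v)\}_{v\in V}$ with $uv\in E$ iff $I(u)\cap I(v)\ne\emptyset$ for distinct $u,v$; $G$ is an interval graph if it has one. $G$ is a proper interval graph if it has an interval representation in which no interval is properly contained in another. An interval graph is exactly hittable if it has an interval representation $\{I(v)\}$ admitting a set $T$ of integers with $|T\cap I(v)|=1$ for every $v$. *)

theory Defs
  imports "Graph_Theory.Pair_Digraph"
begin

(* Finite simple graphs are rendered by the locale predicate pair_graph of Graph_Theory:
   finite vertex set pverts G, symmetric irreflexive edge relation parcs G. *)

definition int_interval :: "int set \<Rightarrow> bool" where
  "int_interval S \<longleftrightarrow> (\<exists>a b. a \<le> b \<and> S = {a..b})"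

(* The values of I outside the vertex set are irrelevant. *)
definition interval_representation :: "'a pair_pre_digraph \<Rightarrow> ('a \<Rightarrow> int set) \<Rightarrow> bool" where
  "interval_representation G I \<longleftrightarrow>
     (\<forall>v\<in>pverts G. int_interval (I v)) \<and>
     (\<forall>u\<in>pverts G. \<forall>v\<in>pverts G. u \<noteq> v \<longrightarrow> ((u, v) \<in> parcs G \<longleftrightarrow> I u \<inter> I v \<noteq> {}))"

definition interval_graph :: "'a pair_pre_digraph \<Rightarrow> bool" where
  "interval_graph G \<longleftrightarrow> pair_graph G \<and> (\<exists>I. interval_representation G I)"

(* Distinct vertices may share the same interval: only proper containment is excluded. *)
definition proper_interval_graph :: "'a pair_pre_digraph \<Rightarrow> bool" where
  "proper_interval_graph G \<longleftrightarrow> pair_graph G \<and>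
     (\<exists>I. interval_representation G I \<and> (\<forall>u\<in>pverts G. \<forall>v\<in>pverts G. \<not> I u \<subset> I v))"

definition exactly_hittable :: "'a pair_pre_digraph \<Rightarrow> bool" where
  "exactly_hittable G \<longleftrightarrow>
     (\<exists>I T. interval_representation G I \<and> (\<forall>v\<in>pverts G. card (T \<inter> I v) = 1))"

definition interval_graphs :: "'a pair_pre_digraph set" where
  "interval_graphs = {G. interval_graph G}"

definition proper_interval_graphs :: "'a pair_pre_digraph set" where
  "proper_interval_graphs = {G. proper_interval_graph G}"

definition exactly_hittable_interval_graphs :: "'a pair_pre_digraph set" where
  "exactly_hittable_interval_graphs = {G. interval_graph G \<and> exactly_hittable G}"

end

theory Submission
  imports Defs
begin

text \<open>Inclusion: in a family of integer intervals without proper containment, stabbing greedily at the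
  smallest right endpoint hits every interval exactly once, since an interval hit twice would properly
  contain the one that caused the second hit.

  Strictness: in every representation of a star, all leaves but the leftmost and the rightmost are
  properly contained in the centre. So \<open>K\<^bsub>1,3\<^esub>\<close>, which is exactly hittable, is not a proper interval
  graph, and the interval graph \<open>K\<^bsub>1,4\<^esub>\<close> is not exactly hittable, because the hits of two disjoint
  inner leaves both lie in the centre.\<close>

lemma int_interval_atLeastAtMost [simp]: "a \<le> b \<Longrightarrow> int_interval {a..b}"
  unfolding int_interval_def by blast

lemma int_interval_singleton [simp]: "int_interval {a}"
  using int_interval_atLeastAtMost[of a a] by simp

lemma interval_representation_endpoints:
  assumes "interval_representation G I"
  obtains l r where "\<And>v. v \<in> pverts G \<Longrightarrow> l v \<le> r v \<and> I v = {l v..r v}"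
proof -
  \<comment> \<open>Pairing the endpoints lets a single use of choice select both.\<close>
  have "\<forall>v\<in>pverts G. \<exists>p. fst p \<le> snd p \<and> I v = {fst p..snd p}"
    using assms unfolding interval_representation_def int_interval_def by fastforce
  then obtain f where "\<forall>v\<in>pverts G. fst (f v) \<le> snd (f v) \<and> I v = {fst (f v)..snd (f v)}"
    by (metis (no_types, lifting) bchoice)
  then show ?thesis by (intro that[of "fst \<circ> f" "snd \<circ> f"]) auto
qed

text \<open>That the hitting set consists of right endpoints is needed in the induction step, to rule out
  a second hit.\<close>

lemma exact_hitting_set_exists:
  fixes l r :: "'a \<Rightarrow> int"
  assumes "finite V" and "\<And>v. v \<in> V \<Longrightarrow> l v \<le> r v"
    and "\<And>u v. u \<in> V \<Longrightarrow> v \<in> V \<Longrightarrow> \<not> {l u..r u} \<subset> {l v..r v}"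
  shows "\<exists>T. T \<subseteq> r ` V \<and> (\<forall>v\<in>V. \<exists>t. T \<inter> {l v..r v} = {t})"
  using assms
proof (induction V rule: finite_psubset_induct)
  case (psubset V)
  show ?case
  proof (cases "V = {}")
    case False
    define p where "p = Min (r ` V)"
    \<comment> \<open>No interval ends before \<open>p\<close>, so \<open>W\<close> collects exactly
      the intervals that \<open>p\<close> misses. An interval ending at \<open>p\<close> is not
      among them, hence the induction hypothesis applies to \<open>W\<close>.\<close>
    define W where "W = {v \<in> V. p < l v}"
    have pV: "p \<in> r ` V" and p_le: "\<And>v. v \<in> V \<Longrightarrow> p \<le> r v"
      using psubset.hyps False by (auto simp: p_def)
    have "W \<subset> V"
    proof -
      obtain w where "w \<in> V" "p = r w" using pV by auto
      then have "w \<in> V - W" using psubset.prems(1)[of w] by (auto simp: W_def)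
      then show ?thesis by (auto simp: W_def)
    qed
    moreover have "\<And>v. v \<in> W \<Longrightarrow> l v \<le> r v"
      and "\<And>u v. u \<in> W \<Longrightarrow> v \<in> W \<Longrightarrow> \<not> {l u..r u} \<subset> {l v..r v}"
      using psubset.prems unfolding W_def by blast+
    ultimately obtain T where T: "T \<subseteq> r ` W" "\<forall>v\<in>W. \<exists>t. T \<inter> {l v..r v} = {t}"
      using psubset.IH[of W] by blast
    have "\<exists>t. insert p T \<inter> {l v..r v} = {t}" if v: "v \<in> V" for v
    proof (cases "v \<in> W")
      case True
      then have "p \<notin> {l v..r v}" by (auto simp: W_def)
      then show ?thesis using T(2) True by auto
    next
      case False
      have "T \<inter> {l v..r v} = {}"
      proof (rule ccontr)
        assume "T \<inter> {l v..r v} \<noteq> {}"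
        then obtain t where t: "t \<in> T" "t \<in> {l v..r v}" by blast
        then obtain w where w: "w \<in> W" "r w \<in> {l v..r v}" using T(1) by blast
        \<comment> \<open>Since \<open>v\<close> lies outside \<open>W\<close>, \<open>l v\<close>
          \<le> \<open>p\<close> < \<open>l w\<close>. As \<open>r w\<close> is also within the
          interval of \<open>v\<close>, the interval of \<open>w\<close> is properly nested in
          it.\<close>
        then have "l v < l w" using False v by (auto simp: W_def)
        moreover have "l w \<le> r w" using w psubset.prems(1) by (auto simp: W_def)
        ultimately have "{l w..r w} \<subset> {l v..r v}" using w by auto
        then show False using psubset.prems(2) v w by (auto simp: W_def)
      qed
      moreover have "p \<in> {l v..r v}" using False v p_le by (auto simp: W_def)
      ultimately show ?thesis by blast
    qed
    moreover have "insert p T \<subseteq> r ` V" using T(1) pV by (auto simp: W_def)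
    ultimately show ?thesis by blast
  qed simp
qed

lemma proper_interval_graph_imp_exactly_hittable:
  assumes "proper_interval_graph G"
  shows "exactly_hittable G"
proof -
  obtain I where I: "interval_representation G I"
    and proper: "\<forall>u\<in>pverts G. \<forall>v\<in>pverts G. \<not> I u \<subset> I v"
    and G: "pair_graph G"
    using assms unfolding proper_interval_graph_def by blast
  obtain l r where lr: "\<And>v. v \<in> pverts G \<Longrightarrow> l v \<le> r v \<and> I v = {l v..r v}"
    using interval_representation_endpoints[OF I] by blast
  have "finite (pverts G)" using G by (rule pair_fin_digraph.pair_finite_verts[OF pair_digraph.axioms(1)[OF pair_graph.axioms(1)]])
  then have "\<exists>T. T \<subseteq> r ` pverts G \<and> (\<forall>v\<in>pverts G. \<exists>t. T \<inter> {l v..r v} = {t})"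
    using lr proper by (intro exact_hitting_set_exists) auto
  then obtain T where "\<forall>v\<in>pverts G. \<exists>t. T \<inter> I v = {t}" using lr by auto
  then have "\<forall>v\<in>pverts G. card (T \<inter> I v) = 1" by (simp add: card_1_singleton_iff)
  then show ?thesis using I unfolding exactly_hittable_def by blast
qed

text \<open>The leaf set is a parameter, so that stars of any required size can be placed inside an
  arbitrary infinite vertex type.\<close>

definition star :: "'a \<Rightarrow> 'a set \<Rightarrow> 'a pair_pre_digraph" where
  "star c L = \<lparr>pverts = insert c L, parcs = {c} \<times> L \<union> L \<times> {c}\<rparr>"

lemma pair_graph_star:
  assumes "finite L" "c \<notin> L"
  shows "pair_graph (star c L)"
  using assms by unfold_locales (auto simp: star_def symmetric_def intro!: symI)

lemma interval_representation_star_iff: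
  assumes "c \<notin> L"
  shows "interval_representation (star c L) I \<longleftrightarrow>
    int_interval (I c) \<and> (\<forall>v\<in>L. int_interval (I v) \<and> I c \<inter> I v \<noteq> {})
    \<and> (\<forall>u\<in>L. \<forall>v\<in>L. u \<noteq> v \<longrightarrow> I u \<inter> I v = {})"
  
proof -
  have ne: "v \<noteq> c" "c \<noteq> v" if "v \<in> L" for v using assms that by auto
  show ?thesis
    by (simp add: interval_representation_def star_def ne Int_commute ball_conj_distrib
        cong: ball_cong)
qed

lemma interval_graph_star:
  assumes "finite L" "c \<notin> L"
  shows "interval_graph (star c L)"
proof -
  \<comment> \<open>Numbering the leaves injectively turns them into distinct points of one long
    interval, that of the centre.\<close>
  obtain h :: "'a \<Rightarrow> nat" and n where h: "h ` L = {i. i < n}" "inj_on h L"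
    using finite_imp_inj_to_nat_seg[OF assms(1)] by blast
  define I where "I v = (if v = c then {0..int n} else {int (h v)})" for v
  have "h v < n" if "v \<in> L" for v using h(1) that by auto
  then have "interval_representation (star c L) I"
    unfolding interval_representation_star_iff[OF assms(2)]
    using h(2) assms(2) by (auto simp: I_def inj_on_def less_imp_le)
  then show ?thesis using pair_graph_star[OF assms] by (auto simp: interval_graph_def)
qed

lemma exactly_hittable_star_3:
  assumes "card L = 3" "c \<notin> L"
  shows "exactly_hittable (star c L)"
proof -
  obtain x y z where L: "L = {x, y, z}" and ne: "x \<noteq> y" "x \<noteq> z" "y \<noteq> z"
    using assms(1) by (auto simp: card_3_iff)
  \<comment> \<open>The intervals of \<open>x\<close> and \<open>z\<close> stick out of the centre
    on either side, so they can be hit at -1 and 4 without hitting the centre. Only \<open>y\<close>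
    shares its hit, 1, with the centre.\<close>
  define I :: "'a \<Rightarrow> int set" where
    "I v = (if v = c then {0..3} else if v = x then {-1..0} else if v = y then {1..2} else {3..4})"
    for v
  have I: "I c = {0..3}" "I x = {-1..0}" "I y = {1..2}" "I z = {3..4}"
    using assms(2) ne L by (auto simp: I_def)
  have "interval_representation (star c L) I"
    unfolding interval_representation_star_iff[OF assms(2)]
    using ne by (auto simp: I L)
  moreover have "{-1, 1, 4} \<inter> I c = {1}" "{-1, 1, 4} \<inter> I x = {-1}"
    "{-1, 1, 4} \<inter> I y = {1}" "{-1, 1, 4} \<inter> I z = {4}"
    by (auto simp: I)
  then have "\<forall>v\<in>pverts (star c L). card ({-1, 1, 4} \<inter> I v) = 1"
    by (simp add: star_def L)
  ultimately show ?thesis unfolding exactly_hittable_def by blast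
qed

text \<open>The leaves are pairwise disjoint, hence ordered along the line. The centre reaches the
  outermost ones on both sides and so covers everything between them.\<close>

lemma star_inner_leaves_psubset_centre:
  assumes I: "interval_representation (star c L) I" and "finite L" "L \<noteq> {}" "c \<notin> L"
  obtains a b where "\<And>v. v \<in> L - {a, b} \<Longrightarrow> I v \<subset> I c"
proof -
  obtain l r where lr: "\<And>v. v \<in> insert c L \<Longrightarrow> l v \<le> r v \<and> I v = {l v..r v}"
    using interval_representation_endpoints[OF I] by (auto simp: star_def)
  \<comment> \<open>The extremal leaves: \<open>a\<close> ends first and \<open>b\<close> starts
    last. They may coincide.\<close>
  have "Min (r ` L) \<in> r ` L" "Max (l ` L) \<in> l ` L" using assms by auto
  then obtain a b where a: "a \<in> L" "r a = Min (r ` L)" and b: "b \<in> L" "l b = Max (l ` L)"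
    by (metis imageE)
  have "I v \<subset> I c" if v: "v \<in> L - {a, b}" for v
  proof -
    have "r a \<le> r v" "l v \<le> l b" using a b v assms(2) by auto
    moreover have "I a \<inter> I v = {}" "I b \<inter> I v = {}" "I c \<inter> I a \<noteq> {}" "I c \<inter> I b \<noteq> {}"
      using I a b v unfolding interval_representation_star_iff[OF assms(4)] by auto
    \<comment> \<open>Disjointness puts \<open>I a\<close> wholly to the left of \<open>I v\<close>,
      and \<open>I c\<close> meets \<open>I a\<close>, so \<open>l c\<close> \<le>
      \<open>r a\<close> < \<open>l v\<close>. The right side is symmetric, with \<open>l b\<close>
      in place of \<open>r a\<close>.\<close>
    ultimately have "l c < l v" "r v < r c"
      using lr[of a] lr[of b] lr[of v] lr[of c] a b v by auto
    then show ?thesis using lr[of v] lr[of c] v by auto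
  qed
  then show ?thesis by (rule that)
qed

lemma not_proper_interval_graph_star:
  assumes "finite L" "card L \<ge> 3" "c \<notin> L"
  shows "\<not> proper_interval_graph (star c L)"
proof
  assume "proper_interval_graph (star c L)"
  then obtain I where I: "interval_representation (star c L) I"
    and proper: "\<forall>u\<in>insert c L. \<forall>v\<in>insert c L. \<not> I u \<subset> I v"
    unfolding proper_interval_graph_def by (auto simp: star_def)
  have "L \<noteq> {}" using assms(2) by auto
  then obtain a b where inner: "\<And>v. v \<in> L - {a, b} \<Longrightarrow> I v \<subset> I c"
    using star_inner_leaves_psubset_centre[OF I assms(1) _ assms(3)] by metis
  have "card (L - {a, b}) \<ge> card L - card {a, b}" by (simp add: diff_card_le_card_Diff)
  moreover have "card {a, b} \<le> 2" by (simp add: card_insert_if)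
  \<comment> \<open>Three leaves guarantee one inner leaf, whose interval violates
    properness.\<close>
  ultimately have "L - {a, b} \<noteq> {}" using assms(2) by fastforce
  then show False using inner proper by blast
qed

lemma not_exactly_hittable_star:
  assumes "finite L" "card L \<ge> 4" "c \<notin> L"
  shows "\<not> exactly_hittable (star c L)"
proof
  assume "exactly_hittable (star c L)"
  then obtain I T where I: "interval_representation (star c L) I"
    and T: "\<forall>v\<in>insert c L. \<exists>t. T \<inter> I v = {t}"
    unfolding exactly_hittable_def by (auto simp: star_def card_1_singleton_iff)
  have "L \<noteq> {}" using assms(2) by auto
  then obtain a b where inner: "\<And>v. v \<in> L - {a, b} \<Longrightarrow> I v \<subset> I c"
    using star_inner_leaves_psubset_centre[OF I assms(1) _ assms(3)] by metis
  have "card (L - {a, b}) \<ge> card L - card {a, b}" by (simp add: diff_card_le_card_Diff)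
  moreover have "card {a, b} \<le> 2" by (simp add: card_insert_if)
  ultimately have "2 \<le> card (L - {a, b})" using assms(2) by linarith
  then obtain D where "D \<subseteq> L - {a, b}" "card D = 2"
    by (metis obtain_subset_with_card_n)
  then obtain u v where uv: "u \<in> L - {a, b}" "v \<in> L - {a, b}" "u \<noteq> v"
    by (auto simp: card_2_iff)
  then have "I u \<inter> I v = {}"
    using I unfolding interval_representation_star_iff[OF assms(3)] by blast
  moreover obtain s where "T \<inter> I u = {s}" using T uv(1) by auto
  moreover obtain t where "T \<inter> I v = {t}" using T uv(2) by auto
  \<comment> \<open>The hits of \<open>u\<close> and \<open>v\<close> differ by disjointness, yet
    both fall into \<open>I c\<close>, which admits only the hit \<open>q\<close>.\<close>
  moreover from calculation have "s \<in> T \<inter> I c" "t \<in> T \<inter> I c"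
    using inner[OF uv(1)] inner[OF uv(2)] by auto
  moreover obtain q where "T \<inter> I c = {q}" using T by auto
  ultimately show False by auto
qed

(* The containments hold over every vertex type; strictness needs a type with enough vertices. *)
theorem theorem3:
  shows "(proper_interval_graphs :: 'a pair_pre_digraph set) \<subseteq> exactly_hittable_interval_graphs
    \<and> (exactly_hittable_interval_graphs :: 'a pair_pre_digraph set) \<subseteq> interval_graphs
    \<and> (infinite (UNIV :: 'a set) \<longrightarrow>
         (proper_interval_graphs :: 'a pair_pre_digraph set) \<subset> exactly_hittable_interval_graphs
         \<and> (exactly_hittable_interval_graphs :: 'a pair_pre_digraph set) \<subset> interval_graphs)"
proof -
  have proper: "(proper_interval_graphs :: 'a pair_pre_digraph set) \<subseteq> exactly_hittable_interval_graphs"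
    using proper_interval_graph_imp_exactly_hittable
    by (auto simp: proper_interval_graphs_def exactly_hittable_interval_graphs_def
        interval_graph_def proper_interval_graph_def)
  have hittable: "(exactly_hittable_interval_graphs :: 'a pair_pre_digraph set) \<subseteq> interval_graphs"
    by (auto simp: exactly_hittable_interval_graphs_def interval_graphs_def)
  have "(proper_interval_graphs :: 'a pair_pre_digraph set) \<noteq> exactly_hittable_interval_graphs
      \<and> (exactly_hittable_interval_graphs :: 'a pair_pre_digraph set) \<noteq> interval_graphs"
    if inf: "infinite (UNIV :: 'a set)"
  proof -
    \<comment> \<open>Any vertex can serve as centre; three leaves around it separate the first two
      classes, four the last two.\<close>
    fix c :: 'a
    have inf_c: "infinite (UNIV - {c})" using inf by simp
    obtain L3 L4 where "finite L3" "card L3 = 3" "c \<notin> L3" and "finite L4" "card L4 = 4" "c \<notin> L4"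
      using infinite_arbitrarily_large[OF inf_c, of 3] infinite_arbitrarily_large[OF inf_c, of 4]
      by blast
    then have "star c L3 \<in> exactly_hittable_interval_graphs - proper_interval_graphs"
      and "star c L4 \<in> interval_graphs - exactly_hittable_interval_graphs"
      by (auto simp: exactly_hittable_interval_graphs_def proper_interval_graphs_def
          interval_graphs_def interval_graph_star exactly_hittable_star_3
          not_proper_interval_graph_star not_exactly_hittable_star)
    then show ?thesis by blast
  qed
  then show ?thesis using proper hittable by blast
qed

end
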